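(* For all integers $g\ge 3$ and $d\ge 1$, there exists a finite non-empty collection $\mathcal{B}$ of axis-aligned boxes in $\mathbb{R}^3$ whose intersection graph is bipartite, has girth at least $g$, and has minimum degree at least $d$.
   Context: An axis-aligned box in $\mathbb{R}^3$ is a set of the form $[a_1,b_1]\times[a_2,b_2]\times[a_3,b_3]$ with real numbers $a_i\le b_i$. The intersection graph of a collection of sets is the simple graph whose vertices are the sets of the collection, two distinct sets being adjacent if and only if they have non-empty intersection. The girth of a graph is the length of its shortest cycle ($\infty$ if the graph has no cycle). *)

theory Defs
  imports "HOL-Analysis.Analysis" "Graph_Theory.Pair_Digraph" "HOL-Library.Extended_Nat"
begin

text \<open>
  Following the convention of the Graph Theory library, a simple graph is a \<^locale>\<open>pair_graph\<close>:
  each undirected edge \<open>uv\<close> is represented by the two arcs \<open>(u, v)\<close> and \<open>(v, u)\<close>.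
\<close>

definition axis_aligned_box :: "(real ^ 3) set \<Rightarrow> bool" where
  "axis_aligned_box S \<longleftrightarrow> (\<exists>a b. (\<forall>i. a $ i \<le> b $ i) \<and> S = cbox a b)"

definition intersection_graph :: "'a set set \<Rightarrow> 'a set pair_pre_digraph" where
  "intersection_graph \<B> =
     \<lparr>pverts = \<B>, parcs = {(A, B). A \<in> \<B> \<and> B \<in> \<B> \<and> A \<noteq> B \<and> A \<inter> B \<noteq> {}}\<rparr>"

lemma pair_graph_intersection_graph:
  assumes "finite \<B>"
  shows "pair_graph (intersection_graph \<B>)"
proof
  have "parcs (intersection_graph \<B>) \<subseteq> \<B> \<times> \<B>"
    by (auto simp: intersection_graph_def)
  then show "finite (parcs (intersection_graph \<B>))"
    using assms by (meson finite_SigmaI finite_subset)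
qed (auto simp: assms intersection_graph_def symmetric_def intro!: symI)

definition bipartite :: "'a pair_pre_digraph \<Rightarrow> bool" where
  "bipartite G \<longleftrightarrow>
     (\<exists>X Y. pverts G = X \<union> Y \<and> X \<inter> Y = {} \<and>
            (\<forall>(u, v) \<in> parcs G. u \<in> X \<and> v \<in> Y \<or> u \<in> Y \<and> v \<in> X))"

text \<open>
  The bound on the length is needed because \<^const>\<open>pre_digraph.cycle\<close> also admits the closed walk
  \<open>u, v, u\<close> along a single undirected edge; in a \<^locale>\<open>pair_graph\<close> the remaining cycles are
  exactly the cycles of the undirected graph. The infimum of the empty set is \<open>\<infinity>\<close>.
\<close>

definition girth :: "'a pair_pre_digraph \<Rightarrow> enat" where
  "girth G = (INF p \<in> {p. pre_digraph.cycle (with_proj G) p \<and> 3 \<le> length p}. enat (length p))"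

text \<open>Only meaningful if the vertex set is finite and non-empty.\<close>

definition min_degree :: "'a pair_pre_digraph \<Rightarrow> nat" where
  "min_degree G = Min (out_degree (with_proj G) ` pverts G)"

end

theory Submission
  imports Defs
begin

text \<open>
  It suffices to find finitely many points and axis-parallel rectangles in the plane whose incidence
  graph has large girth and large minimum degree: in space, a point becomes a vertical segment and a
  rectangle becomes a flat box at a height of its own.

  Such configurations are built by induction on the number of rectangles through each point. Stack
  many copies of a configuration on top of each other so that all copies of a point \<open>p\<close> lie in a thin
  vertical strip. The horizontal order of the copies within the strip is free, so any partition of
  the set of copies can be cut out by tall thin rectangles, one per class. A short cycle through the
  new rectangles projects to a short cycle in the hypergraph of all these classes. Partitions without
  short cycles, one for each point \<open>p\<close>, come from permutations of a truncated tree of reduced words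
  (the tree of a free product of cyclic groups), where the colour of \<open>p\<close> rotates first letters.
\<close>

subsection \<open>Partitions without short cycles\<close>

text \<open>
  \<open>R e p q\<close> says that \<open>p\<close> and \<open>q\<close> both lie on the hyperedge \<open>e\<close>. A walk is recorded by its length,
  first vertex, last hyperedge and last vertex; consecutive vertices and consecutive hyperedges
  are distinct, so that a closed walk yields a cycle.
\<close>

inductive walk :: "('e \<Rightarrow> 'a \<Rightarrow> 'a \<Rightarrow> bool) \<Rightarrow> nat \<Rightarrow> 'a \<Rightarrow> 'e \<Rightarrow> 'a \<Rightarrow> bool"
  for R where
  walk_one: "R e p q \<Longrightarrow> p \<noteq> q \<Longrightarrow> walk R 1 p e q"
| walk_Suc: "walk R n p e q \<Longrightarrow> R f q q' \<Longrightarrow> q \<noteq> q' \<Longrightarrow> e \<noteq> f \<Longrightarrow> walk R (Suc n) p f q'"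

text \<open>The first and last hyperedge of a closed walk may coincide and inner vertices may
  repeat, so no genuine cycle ever has to be extracted from a walk.\<close>

definition no_short_cycle :: "('e \<Rightarrow> 'a \<Rightarrow> 'a \<Rightarrow> bool) \<Rightarrow> nat \<Rightarrow> bool" where
  "no_short_cycle R g \<longleftrightarrow> (\<forall>n\<le>g. \<forall>p e. \<not> walk R n p e p)"

lemma walk_map:
  assumes "walk R n p e q"
    and "\<And>e p q. R e p q \<Longrightarrow> S e (h p) (h q)"
    and "\<And>e p q. R e p q \<Longrightarrow> p \<noteq> q \<Longrightarrow> h p \<noteq> h q"
  shows "walk S n (h p) e (h q)"
  using assms(1) by induction (auto intro: walk.intros simp del: One_nat_def simp: assms(2,3))

section \<open>Reduced words and their block rotations\<close>

fun pos :: "'i \<Rightarrow> ('i \<times> nat) list \<Rightarrow> nat" where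
  "pos i [] = 0"
| "pos i ((j, t) # w) = (if j = i then t else 0)"

fun rest :: "'i \<Rightarrow> ('i \<times> nat) list \<Rightarrow> ('i \<times> nat) list" where
  "rest i [] = []"
| "rest i ((j, t) # w) = (if j = i then w else (j, t) # w)"

text \<open>Exponent 0 stands for an absent letter. So every reduced word \<open>w\<close> splits as
  \<open>put i t b\<close>, where \<open>t = pos i w\<close> is its place in a
  colour-\<open>i\<close> block and \<open>b = rest i w\<close> is the base of that block.\<close>

definition put :: "'i \<Rightarrow> nat \<Rightarrow> ('i \<times> nat) list \<Rightarrow> ('i \<times> nat) list" where
  "put i t w = (if t = 0 then w else (i, t) # w)"

text \<open>
  In the tree of words, \<open>rot d r i s\<close> shifts the colour-\<open>i\<close> block \<open>{b} \<union> {(i, t) # b | 0 < t < d}\<close>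
  cyclically by \<open>s\<close>; it fixes the words of length \<open>r\<close> that do not start with colour \<open>i\<close>.
\<close>

definition rot :: "nat \<Rightarrow> nat \<Rightarrow> 'i \<Rightarrow> nat \<Rightarrow> ('i \<times> nat) list \<Rightarrow> ('i \<times> nat) list" where
  "rot d r i s w =
     (if length (rest i w) < r then put i ((pos i w + s) mod d) (rest i w) else w)"

text \<open>For positive \<open>d\<close>, these are the normal forms of syllable length at most
  \<open>r\<close> in the free product of cyclic groups of order \<open>d\<close> indexed by
  \<open>I\<close>; the letter \<open>(i, t)\<close> is the \<open>t\<close>-th power of generator
  \<open>i\<close>. On them \<open>rot d r i s\<close> is a truncated left multiplication.\<close>

definition reduced_words :: "'i set \<Rightarrow> nat \<Rightarrow> nat \<Rightarrow> ('i \<times> nat) list set" where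
  "reduced_words I d r =
     {w. set w \<subseteq> I \<times> {1..<d} \<and> length w \<le> r \<and> successively (\<lambda>x y. fst x \<noteq> fst y) w}"

lemma finite_reduced_words: "finite I \<Longrightarrow> finite (reduced_words I d r)"
  unfolding reduced_words_def
  by (rule finite_subset[OF _ finite_lists_length_le[of "I \<times> {1..<d}" r]]) auto

lemma rest_rest:
  assumes "w \<in> reduced_words I d r"
  shows "rest i (rest i w) = rest i w" "pos i (rest i w) = 0"
proof -
  have "rest i (rest i w) = rest i w \<and> pos i (rest i w) = 0"
  proof (cases w)
    case (Cons a w')
    then show ?thesis using assms
      by (cases a; cases w') (auto simp: reduced_words_def)
  qed auto
  then show "rest i (rest i w) = rest i w" "pos i (rest i w) = 0" by auto
qed

lemma put_pos_rest: "w \<in> reduced_words I d r \<Longrightarrow> put i (pos i w) (rest i w) = w"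
  by (cases w) (auto simp: reduced_words_def put_def split: if_splits)

lemma pos_less: "0 < d \<Longrightarrow> w \<in> reduced_words I d r \<Longrightarrow> pos i w < d"
  by (cases w) (auto simp: reduced_words_def)

lemma pos_put: "pos i w = 0 \<Longrightarrow> pos i (put i t w) = t"
  by (simp add: put_def)

lemma rest_put: "rest i w = w \<Longrightarrow> rest i (put i t w) = w"
  by (simp add: put_def)

lemma rest_in_reduced_words: "w \<in> reduced_words I d r \<Longrightarrow> rest i w \<in> reduced_words I d r"
  by (cases w) (auto simp: reduced_words_def successively_Cons split: if_splits)

lemma rot_in_reduced_words:
  assumes "w \<in> reduced_words I d r" "i \<in> I" "0 < d"
  shows "rot d r i s w \<in> reduced_words I d r"
proof -
  let ?b = "rest i w"
  have b: "?b \<in> reduced_words I d r" by (rule rest_in_reduced_words[OF assms(1)])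
  have "rest i ?b = ?b" by (rule rest_rest[OF assms(1)])
  then have hd: "?b \<noteq> [] \<Longrightarrow> fst (hd ?b) \<noteq> i"
    by (cases ?b) (auto split: if_splits)
  have "put i ((pos i w + s) mod d) ?b \<in> reduced_words I d r" if "length ?b < r"
    using b hd that assms(2,3)
    by (auto simp: put_def reduced_words_def successively_Cons)
  then show ?thesis using assms(1) by (simp add: rot_def)
qed

lemma rot_rot:
  assumes "w \<in> reduced_words I d r"
  shows "rot d r i s (rot d r i s' w) = rot d r i (s' + s) w"
  by (simp add: rot_def pos_put rest_put rest_rest[OF assms] mod_add_left_eq add.assoc)

lemma rot_dvd:
  assumes "w \<in> reduced_words I d r" "d dvd s" "0 < d"
  shows "rot d r i s w = w"
proof -
  have "(pos i w + s) mod d = pos i w"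
    using assms pos_less[OF assms(3,1), of i] by (auto simp: dvd_def)
  then show ?thesis by (simp add: rot_def put_pos_rest[OF assms(1)])
qed

text \<open>Shifts are natural numbers, so \<open>s * (d - 1)\<close> serves as \<open>-s\<close>
  modulo \<open>d\<close>.\<close>

lemma rot_inverse:
  assumes "w \<in> reduced_words I d r" "0 < d"
  shows "rot d r i (s * (d - 1)) (rot d r i s w) = w"
    "rot d r i s (rot d r i (s * (d - 1)) w) = w"
proof -
  have *: "s + s * (d - 1) = s * d" using assms(2) by (cases d) auto
  then show "rot d r i (s * (d - 1)) (rot d r i s w) = w"
    by (simp add: rot_rot[OF assms(1)] rot_dvd[OF assms(1) _ assms(2)])
  show "rot d r i s (rot d r i (s * (d - 1)) w) = w"
    using * by (simp add: rot_rot[OF assms(1)] rot_dvd[OF assms(1) _ assms(2)] add.commute)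
qed

lemma rot_image:
  assumes "i \<in> I" "0 < d"
  shows "rot d r i s ` reduced_words I d r = reduced_words I d r"
proof
  show "rot d r i s ` reduced_words I d r \<subseteq> reduced_words I d r"
    using rot_in_reduced_words[OF _ assms] by blast
  show "reduced_words I d r \<subseteq> rot d r i s ` reduced_words I d r"
    using rot_in_reduced_words[OF _ assms] rot_inverse(2)[OF _ assms(2)]
    by (metis image_eqI subsetI)
qed

section \<open>Rotations acting on orderings of the words\<close>

text \<open>For finite \<open>T\<close> the length condition forces distinct entries. A map applied
  entrywise fixes an ordering only if it fixes every word, so all shift classes of orderings are
  large; on the words themselves, those fixed by \<open>rot\<close> would form singleton
  classes.\<close>

definition arrangements :: "'a set \<Rightarrow> 'a list set" where
  "arrangements T = {xs. set xs = T \<and> length xs = card T}"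

lemma finite_arrangements: "finite T \<Longrightarrow> finite (arrangements T)"
  unfolding arrangements_def
  by (rule finite_subset[OF _ finite_lists_length_eq[of T "card T"]]) auto

lemma arrangements_nonempty: "finite T \<Longrightarrow> arrangements T \<noteq> {}"
  using finite_distinct_list[of T] by (auto simp: arrangements_def distinct_card)

text \<open>Orbits of one colour are disjoint, so the colour can name them all: distinct orbits
  through a common vertex have distinct colours.\<close>

definition rot_rel :: "'i set \<Rightarrow> nat \<Rightarrow> nat \<Rightarrow> 'i \<Rightarrow> ('i \<times> nat) list list \<Rightarrow> ('i \<times> nat) list list \<Rightarrow> bool" where
  "rot_rel I d r i xs ys \<longleftrightarrow> i \<in> I \<and> xs \<in> arrangements (reduced_words I d r) \<and>
     (\<exists>s. ys = map (rot d r i s) xs)"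

lemma map_rot_arrangements:
  assumes "xs \<in> arrangements (reduced_words I d r)" "i \<in> I" "0 < d"
  shows "map (rot d r i s) xs \<in> arrangements (reduced_words I d r)"
  using assms rot_image[OF assms(2,3)] by (simp add: arrangements_def)

lemma map_rot_rot:
  assumes "xs \<in> arrangements (reduced_words I d r)"
  shows "map (rot d r i s) (map (rot d r i s') xs) = map (rot d r i (s' + s)) xs"
  using assms by (auto simp: arrangements_def rot_rot)

lemma equiv_rot_rel:
  assumes "0 < d" "i \<in> I"
  shows "equiv (arrangements (reduced_words I d r)) {(xs, ys). rot_rel I d r i xs ys}"
proof (rule equivI)
  let ?V = "arrangements (reduced_words I d r)"
  have id: "map (rot d r i 0) xs = xs" if "xs \<in> ?V" for xs
    using that assms(1) by (auto simp: arrangements_def rot_dvd intro: map_idI)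
  show "{(xs, ys). rot_rel I d r i xs ys} \<subseteq> ?V \<times> ?V"
    using map_rot_arrangements[OF _ assms(2,1)] by (auto simp: rot_rel_def)
  show "refl_on ?V {(xs, ys). rot_rel I d r i xs ys}"
    using id assms(2) by (auto simp: refl_on_def rot_rel_def) (metis)
  show "sym {(xs, ys). rot_rel I d r i xs ys}"
  proof (rule symI, clarsimp simp: rot_rel_def, intro conjI)
    fix xs s assume xs: "xs \<in> ?V" "i \<in> I"
    show "map (rot d r i s) xs \<in> ?V" by (rule map_rot_arrangements[OF xs assms(1)])
    have "map (rot d r i (s * (d - 1))) (map (rot d r i s) xs) = xs"
      unfolding map_map using xs(1) assms(1)
      by (intro map_idI) (auto simp: arrangements_def rot_inverse simp del: One_nat_def)
    then show "\<exists>t. xs = map (rot d r i t \<circ> rot d r i s) xs" by (metis map_map)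
  qed
  show "trans {(xs, ys). rot_rel I d r i xs ys}"
  proof (rule transI)
    fix xs ys zs
    assume "(xs, ys) \<in> {(xs, ys). rot_rel I d r i xs ys}"
      "(ys, zs) \<in> {(xs, ys). rot_rel I d r i xs ys}"
    then obtain s t where "i \<in> I" "xs \<in> ?V" "ys = map (rot d r i s) xs"
      "zs = map (rot d r i t) ys" unfolding rot_rel_def by blast
    then show "(xs, zs) \<in> {(xs, ys). rot_rel I d r i xs ys}"
      using map_rot_rot[of xs I d r i t s] unfolding rot_rel_def by blast
  qed
qed

lemma rot_Nil: "1 \<le> r \<Longrightarrow> rot d r i s [] = put i (s mod d) []"
  by (simp add: rot_def)

text \<open>The shifts by \<open>0, ..., d - 1\<close> already differ at the empty word, which
  \<open>r >= 1\<close> keeps movable.\<close>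

lemma card_rot_rel:
  assumes "1 \<le> r" "0 < d" "i \<in> I" "finite I" "xs \<in> arrangements (reduced_words I d r)"
  shows "d \<le> card {ys. rot_rel I d r i xs ys}"
proof -
  let ?V = "arrangements (reduced_words I d r)"
  have nil: "[] \<in> set xs" using assms(5) by (simp add: arrangements_def reduced_words_def)
  have "inj_on (\<lambda>s. map (rot d r i s) xs) {..<d}"
  proof (rule inj_onI)
    fix s t assume st: "s \<in> {..<d}" "t \<in> {..<d}" "map (rot d r i s) xs = map (rot d r i t) xs"
    then have "rot d r i s [] = rot d r i t []" using nil by (simp add: map_eq_conv)
    then show "s = t" using st(1,2) assms(1) by (auto simp: rot_Nil put_def split: if_splits)
  qed
  then have "card ((\<lambda>s. map (rot d r i s) xs) ` {..<d}) = d" by (simp add: card_image)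
  moreover have "{ys. rot_rel I d r i xs ys} \<subseteq> ?V"
    using map_rot_arrangements[OF _ assms(3,2)] by (auto simp: rot_rel_def)
  then have "finite {ys. rot_rel I d r i xs ys}"
    using finite_arrangements[OF finite_reduced_words[OF assms(4)]] finite_subset by blast
  moreover have "(\<lambda>s. map (rot d r i s) xs) ` {..<d} \<subseteq> {ys. rot_rel I d r i xs ys}"
    using assms(3,5) by (auto simp: rot_rel_def)
  ultimately show ?thesis by (metis card_mono)
qed

text \<open>A walk of length \<open>n \<le> r\<close> moves the empty word to a word of length \<open>n\<close>, so it is not closed.\<close>

lemma walk_rot_rel:
  assumes "walk (rot_rel I d r) n xs i ys" "n \<le> r" "0 < d"
  shows "xs \<in> arrangements (reduced_words I d r) \<and>
    (\<exists>f. ys = map f xs \<and> f ` reduced_words I d r \<subseteq> reduced_words I d r \<and>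
       length (f []) = n \<and> f [] \<noteq> [] \<and> fst (hd (f [])) = i)"
  using assms(1,2)
proof induction
  case (walk_one i xs ys)
  then obtain s where s: "i \<in> I" "xs \<in> arrangements (reduced_words I d r)"
    "ys = map (rot d r i s) xs" by (auto simp: rot_rel_def)
  have "\<not> d dvd s"
  proof
    assume "d dvd s"
    then have "ys = xs" using s(2,3) assms(3)
      by (auto simp: arrangements_def rot_dvd intro!: map_idI)
    then show False using walk_one by simp
  qed
  then have "rot d r i s [] = [(i, s mod d)]"
    using walk_one by (simp add: rot_Nil put_def dvd_eq_mod_eq_0)
  then show ?case using s rot_image[OF s(1) assms(3)] by (intro conjI exI[of _ "rot d r i s"]) auto
next
  case (walk_Suc n xs e ys i zs)
  then obtain f where f: "xs \<in> arrangements (reduced_words I d r)" "ys = map f xs"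
    "f ` reduced_words I d r \<subseteq> reduced_words I d r"
    "length (f []) = n" "f [] \<noteq> []" "fst (hd (f [])) = e" by auto
  obtain s where s: "i \<in> I" "ys \<in> arrangements (reduced_words I d r)"
    "zs = map (rot d r i s) ys" using walk_Suc by (auto simp: rot_rel_def)
  have "\<not> d dvd s"
  proof
    assume "d dvd s"
    then have "zs = ys" using s(2,3) assms(3)
      by (auto simp: arrangements_def rot_dvd intro!: map_idI)
    then show False using walk_Suc by simp
  qed
  \<comment> \<open>The first letter of \<open>f []\<close> has colour \<open>e\<close>, not
    \<open>i\<close>, so the rotation puts a new letter in front; \<open>n < r\<close> leaves room
    for it.\<close>
  moreover have "rest i (f []) = f []" "pos i (f []) = 0"
    using f(5,6) \<open>e \<noteq> i\<close> by (cases "f []"; auto)+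
  ultimately have "rot d r i s (f []) = (i, s mod d) # f []"
    using f(4) walk_Suc(6) by (simp add: rot_def put_def dvd_eq_mod_eq_0)
  then show ?case using f s rot_image[OF s(1) assms(3), of r s]
    by (intro conjI exI[of _ "rot d r i s \<circ> f"]) auto
qed

lemma no_short_cycle_rot_rel:
  assumes "0 < d"
  shows "no_short_cycle (rot_rel I d r) r"
  unfolding no_short_cycle_def
proof (intro allI impI notI)
  fix n xs i assume "n \<le> r" and w: "walk (rot_rel I d r) n xs i xs"
  from walk_rot_rel[OF w this(1) assms] obtain f
    where f: "xs \<in> arrangements (reduced_words I d r)" "xs = map f xs" "f [] \<noteq> []" by blast
  have "[] \<in> set xs" using f(1) by (simp add: arrangements_def reduced_words_def)
  moreover have "\<forall>x\<in>set xs. f x = x" using f(2) by (metis map_eq_conv map_ident)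
  ultimately show False using f(3) by blast
qed

text \<open>Codes the orderings as natural numbers, which can enter coordinates. Each class is named
  by its least code, so labels lie in \<open>W\<close> again and one bound covers copies and
  labels.\<close>

lemma ex_labelling:
  fixes I :: "'i :: countable set"
  assumes "finite I"
  obtains W :: "nat set" and lab :: "'i \<Rightarrow> nat \<Rightarrow> nat"
  where "finite W" "W \<noteq> {}"
    "\<And>i v. i \<in> I \<Longrightarrow> v \<in> W \<Longrightarrow> lab i v \<in> W"
    "\<And>i v. i \<in> I \<Longrightarrow> v \<in> W \<Longrightarrow> d \<le> card {u \<in> W. lab i u = lab i v}"
    "no_short_cycle (\<lambda>i u v. i \<in> I \<and> u \<in> W \<and> v \<in> W \<and> lab i u = lab i v) g"
proof -
  \<comment> \<open>\<open>Suc\<close> keeps both parameters positive even if \<open>d\<close> or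
    \<open>g\<close> is 0.\<close>
  define D r where "D = Suc d" and "r = Suc g"
  define V where "V = arrangements (reduced_words I D r)"
  define W where "W = to_nat ` V"
  let ?Q = "\<lambda>i. {(xs, ys). rot_rel I D r i xs ys}"
  define lab where "lab i v = (LEAST u. u \<in> to_nat ` (?Q i `` {from_nat v}))" for i v
  have eq: "equiv V (?Q i)" if "i \<in> I" for i
    using equiv_rot_rel[OF _ that] by (simp add: V_def D_def)
  have V: "finite V" "V \<noteq> {}"
    unfolding V_def
    by (intro finite_arrangements arrangements_nonempty finite_reduced_words assms)+
  have lab_in: "lab i v \<in> to_nat ` (?Q i `` {from_nat v})" if "i \<in> I" "from_nat v \<in> V" for i v
  proof -
    have "from_nat v \<in> ?Q i `` {from_nat v}" by (rule equiv_class_self[OF eq[OF that(1)] that(2)])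
    then have "to_nat (from_nat v :: ('i \<times> nat) list list) \<in> to_nat ` (?Q i `` {from_nat v})"
      by (rule imageI)
    then show ?thesis unfolding lab_def by (rule LeastI)
  qed
  have lab_eq: "lab i (to_nat xs) = lab i (to_nat ys) \<longleftrightarrow> rot_rel I D r i xs ys"
    if "i \<in> I" "xs \<in> V" "ys \<in> V" for i xs ys
  proof
    assume "rot_rel I D r i xs ys"
    then have "?Q i `` {xs} = ?Q i `` {ys}" using equiv_class_eq[OF eq[OF that(1)]] by blast
    then show "lab i (to_nat xs) = lab i (to_nat ys)" by (simp add: lab_def)
  next
    assume "lab i (to_nat xs) = lab i (to_nat ys)"
    then have "?Q i `` {xs} \<inter> ?Q i `` {ys} \<noteq> {}"
      using lab_in[OF that(1), of "to_nat xs"] lab_in[OF that(1), of "to_nat ys"] that(2,3)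
      by force
    then show "rot_rel I D r i xs ys"
      using equiv_class_nondisjoint[OF eq[OF that(1)], of _ xs ys] by blast
  qed
  have sub: "?Q i `` {xs} \<subseteq> V" if "i \<in> I" for i xs
    using equiv_type[OF eq[OF that]] by blast
  show thesis
  proof
    show "finite W" "W \<noteq> {}" using V by (auto simp: W_def)
    show "lab i v \<in> W" if "i \<in> I" "v \<in> W" for i v
      using lab_in[OF that(1), of v] sub[OF that(1), of "from_nat v"] that(2)
      unfolding W_def by force
    show "d \<le> card {u \<in> W. lab i u = lab i v}" if i: "i \<in> I" and v: "v \<in> W" for i v
    proof -
      obtain xs where xs: "xs \<in> V" "v = to_nat xs" using v by (auto simp: W_def)
      have "to_nat ` {ys. rot_rel I D r i xs ys} \<subseteq> {u \<in> W. lab i u = lab i v}"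
      proof (rule image_subsetI)
        fix ys assume "ys \<in> {ys. rot_rel I D r i xs ys}"
        moreover from this have "ys \<in> V" using sub[OF i, of xs] by auto
        ultimately have "lab i (to_nat xs) = lab i (to_nat ys)" "ys \<in> V"
          using lab_eq[OF i xs(1)] by auto
        then show "to_nat ys \<in> {u \<in> W. lab i u = lab i v}"
          using xs(2) by (simp add: W_def)
      qed
      moreover have "card (to_nat ` {ys. rot_rel I D r i xs ys}) = card {ys. rot_rel I D r i xs ys}"
        by (rule card_image) (simp add: inj_on_def)
      moreover have "D \<le> card {ys. rot_rel I D r i xs ys}"
        using card_rot_rel[of r D i I xs] i assms xs(1) by (simp add: r_def D_def V_def)
      moreover have "finite {u \<in> W. lab i u = lab i v}" using V by (simp add: W_def)
      ultimately show ?thesis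
        by (metis (no_types, lifting) D_def Suc_leD card_mono le_trans)
    qed
    show "no_short_cycle (\<lambda>i u v. i \<in> I \<and> u \<in> W \<and> v \<in> W \<and> lab i u = lab i v) g"
      unfolding no_short_cycle_def
    proof (intro allI impI notI)
      fix n p e
      assume n: "n \<le> g" and
        w: "walk (\<lambda>i u v. i \<in> I \<and> u \<in> W \<and> v \<in> W \<and> lab i u = lab i v) n p e p"
      have "walk (rot_rel I D r) n (from_nat p) e (from_nat p)"
        using w by (rule walk_map) (auto simp: W_def lab_eq)
      then show False
        using no_short_cycle_rot_rel[of D I r] n by (auto simp: no_short_cycle_def D_def r_def)
    qed
  qed
qed

subsection \<open>Joining layers\<close>

text \<open>The combinatorial half of the induction step: \<open>W\<close> indexes the copies,
  \<open>old f u\<close> is hyperedge \<open>f\<close> in copy \<open>u\<close>, and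
  \<open>new p l\<close> joins the copies of \<open>p\<close> in class \<open>l\<close>.\<close>

lemma no_short_cycle_layers:
  fixes lab :: "'a \<Rightarrow> 'v \<Rightarrow> 'l" and pt :: "'a \<Rightarrow> 'v \<Rightarrow> 'b"
    and old :: "'e \<Rightarrow> 'v \<Rightarrow> 'f" and new :: "'a \<Rightarrow> 'l \<Rightarrow> 'f"
  assumes R: "no_short_cycle R g"
    and S: "no_short_cycle (\<lambda>i u v. i \<in> P \<and> u \<in> W \<and> v \<in> W \<and> lab i u = lab i v) g"
    and pt: "\<And>p q u v. p \<in> P \<Longrightarrow> q \<in> P \<Longrightarrow> u \<in> W \<Longrightarrow> v \<in> W \<Longrightarrow> pt p u = pt q v \<Longrightarrow> p = q \<and> u = v"
    and T: "\<And>e x y. T e x y \<Longrightarrow>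
      (\<exists>f u p q. u \<in> W \<and> p \<in> P \<and> q \<in> P \<and> e = old f u \<and> x = pt p u \<and> y = pt q u \<and> R f p q) \<or>
      (\<exists>p u v. p \<in> P \<and> u \<in> W \<and> v \<in> W \<and> lab p u = lab p v \<and> e = new p (lab p u) \<and>
         x = pt p u \<and> y = pt p v)"
  shows "no_short_cycle T g"
proof -
  let ?S = "\<lambda>i u v. i \<in> P \<and> u \<in> W \<and> v \<in> W \<and> lab i u = lab i v"
  have Rc: "\<not> walk R n p e p" if "n \<le> g" for n p e
    using R that by (auto simp: no_short_cycle_def)
  have Sc: "\<not> walk ?S n p e p" if "n \<le> g" for n p e
    using S that by (auto simp: no_short_cycle_def)
  \<comment> \<open>A walk has stayed in one copy, or has just used a new edge, or is inside a copy after its last new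
    edge; in the latter two cases it projects to a walk between copies. The segment inside a copy
    between two new edges is not closed, which makes the colours of consecutive new edges distinct.\<close>
  define inside where "inside n p u q v e \<longleftrightarrow> (\<exists>f. u = v \<and> e = old f v \<and> walk R n p f q)"
    for n p u q v e
  define at_new where "at_new n u q v e \<longleftrightarrow> (\<exists>m\<le>n. e = new q (lab q v) \<and> walk ?S m u q v)"
    for n u q v e
  define after_new where "after_new n u q v e \<longleftrightarrow>
      (\<exists>f m n' p'. m \<le> n \<and> n' \<le> n \<and> walk ?S m u p' v \<and> e = old f v \<and> walk R n' p' f q)"
    for n u q v e
  have main: "\<exists>p u q v. p \<in> P \<and> q \<in> P \<and> u \<in> W \<and> v \<in> W \<and> x = pt p u \<and> y = pt q v \<and>
      (inside n p u q v e \<or> at_new n u q v e \<or> after_new n u q v e)"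
    if "walk T n x e y" "n \<le> g" for n x e y
    using that
  proof induction
    case (walk_one e x y)
    from T[OF walk_one(1)] show ?case
    proof (elim disjE exE conjE)
      fix f u p q
      assume *: "u \<in> W" "p \<in> P" "q \<in> P" "e = old f u" "x = pt p u" "y = pt q u" "R f p q"
      then have "inside 1 p u q u e"
        using walk.walk_one[of R f p q] walk_one(2) by (auto simp: inside_def)
      then show ?thesis using * by blast
    next
      fix p u v
      assume *: "p \<in> P" "u \<in> W" "v \<in> W" "lab p u = lab p v" "e = new p (lab p u)"
        "x = pt p u" "y = pt p v"
      then have "at_new 1 u p v e"
        using walk.walk_one[of ?S p u v] walk_one(2) unfolding at_new_def by auto
      then show ?thesis using * by blast
    qed
  next
    case (walk_Suc n x e y e' z)
    then obtain p u q v where 1: "p \<in> P" "q \<in> P" "u \<in> W" "v \<in> W" "x = pt p u" "y = pt q v"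
      "inside n p u q v e \<or> at_new n u q v e \<or> after_new n u q v e" by auto
    from T[OF walk_Suc(2)] show ?case
    proof (elim disjE exE conjE)
      fix f v' q' r
      assume "v' \<in> W" "q' \<in> P" and r: "r \<in> P" and e': "e' = old f v'" and "y = pt q' v'"
        and z: "z = pt r v'" and "R f q' r"
      then have eq: "v' = v" "q' = q" using pt 1 by metis+
      have f: "R f q r" "q \<noteq> r" using \<open>R f q' r\<close> eq z 1 walk_Suc(3) by auto
      from 1(7) have "inside (Suc n) p u r v e' \<or> after_new (Suc n) u r v e'"
      proof (elim disjE)
        assume "inside n p u q v e"
        then show ?thesis using e' f eq walk_Suc(4) walk.walk_Suc[of R n p _ q f r]
          unfolding inside_def by metis
      next
        assume "at_new n u q v e"
        then obtain m where "m \<le> n" "walk ?S m u q v" unfolding at_new_def by blast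
        moreover have "walk R 1 q f r" using f by (rule walk.walk_one)
        ultimately have "after_new (Suc n) u r v e'"
          unfolding after_new_def using e' eq
          by (intro exI[of _ f] exI[of _ m] exI[of _ 1] exI[of _ q]) simp
        then show ?thesis ..
      next
        assume "after_new n u q v e"
        then obtain f' m n' p' where *: "m \<le> n" "n' \<le> n" "walk ?S m u p' v" "e = old f' v"
          "walk R n' p' f' q" unfolding after_new_def by blast
        then have "walk R (Suc n') p' f r"
          using f e' eq walk_Suc(4) by (intro walk.walk_Suc[of R n' p' f' q]) auto
        with * have "after_new (Suc n) u r v e'"
          unfolding after_new_def using e' eq
          by (intro exI[of _ f] exI[of _ m] exI[of _ "Suc n'"] exI[of _ p']) simp
        then show ?thesis ..
      qed
      then show ?thesis using 1 r z eq by blast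
    next
      fix q' v' w
      assume "q' \<in> P" "v' \<in> W" and w: "w \<in> W" "lab q' v' = lab q' w"
        and e': "e' = new q' (lab q' v')" and "y = pt q' v'" and z: "z = pt q' w"
      then have eq: "v' = v" "q' = q" using pt 1 by metis+
      have s: "?S q v w" "v \<noteq> w" using eq 1 w walk_Suc(3) z by auto
      from 1(7) have "at_new (Suc n) u q w e'"
      proof (elim disjE)
        assume "inside n p u q v e"
        \<comment> \<open>The stretch inside copy \<open>v\<close> projects to a single vertex, so
          the walk between copies starts here.\<close>
        then show ?thesis using walk.walk_one[of ?S q v w] s e' eq
          unfolding inside_def at_new_def by (auto intro!: exI[of _ 1])
      next
        assume "at_new n u q v e"
        \<comment> \<open>Two consecutive new edges at \<open>pt q v\<close> would both be
          \<open>new q (lab q v)\<close>, but consecutive hyperedges are distinct.\<close>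
        then show ?thesis using walk_Suc(4) e' eq by (auto simp: at_new_def)
      next
        assume "after_new n u q v e"
        then obtain f m n' p' where 2: "m \<le> n" "n' \<le> n" "walk ?S m u p' v" "walk R n' p' f q"
          unfolding after_new_def by blast
        have "p' \<noteq> q" using Rc[of n' q f] 2(2,4) walk_Suc(6) by auto
        then have "walk ?S (Suc m) u q w" using walk.walk_Suc[of ?S m u p' v q w] 2(3) s by blast
        then show ?thesis using 2(1) e' eq s unfolding at_new_def
          by (intro exI[of _ "Suc m"]) simp
      qed
      then show ?thesis using 1 w z eq by blast
    qed
  qed
  show ?thesis unfolding no_short_cycle_def
  proof (intro allI impI notI)
    fix n x e assume n: "n \<le> g" and "walk T n x e x"
    \<comment> \<open>By injectivity of \<open>pt\<close>, the walk closes up inside one copy or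
      projects to a closed walk between copies, of length at most \<open>g\<close> either
      way.\<close>
    from main[OF this(2,1)] obtain p u where
      "inside n p u p u e \<or> at_new n u p u e \<or> after_new n u p u e"
      using pt by metis
    then show False
      using n Rc Sc unfolding inside_def at_new_def after_new_def by (meson le_trans)
  qed
qed

subsection \<open>Points and rectangles\<close>

type_synonym point = "nat \<times> nat"
type_synonym rect = "nat \<times> nat \<times> nat \<times> nat"

fun in_rect :: "rect \<Rightarrow> point \<Rightarrow> bool" where
  "in_rect (a, b, c, d) (x, y) \<longleftrightarrow> a \<le> x \<and> x \<le> b \<and> c \<le> y \<and> y \<le> d"

definition joined :: "point set \<Rightarrow> rect set \<Rightarrow> rect \<Rightarrow> point \<Rightarrow> point \<Rightarrow> bool" where
  "joined P E e p q \<longleftrightarrow> e \<in> E \<and> p \<in> P \<and> q \<in> P \<and> in_rect e p \<and> in_rect e q"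

text \<open>Distinct first coordinates give every point a vertical strip of its own when copies are
  stacked.\<close>

definition configuration :: "nat \<Rightarrow> nat \<Rightarrow> nat \<Rightarrow> point set \<Rightarrow> rect set \<Rightarrow> bool" where
  "configuration g d k P E \<longleftrightarrow>
     finite P \<and> P \<noteq> {} \<and> finite E \<and> inj_on fst P \<and>
     (\<forall>e\<in>E. d \<le> card {p \<in> P. in_rect e p}) \<and>
     (\<forall>p\<in>P. k \<le> card {e \<in> E. in_rect e p}) \<and>
     no_short_cycle (joined P E) g"

section \<open>Coordinates in base \<open>n\<close>\<close>

lemma mult_add_eq_iff:
  fixes a b c d n :: nat
  assumes "c < n" "d < n"
  shows "a * n + c = b * n + d \<longleftrightarrow> a = b \<and> c = d"
proof
  assume *: "a * n + c = b * n + d"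
  have "(a * n + c) div n = a" "(b * n + d) div n = b" using assms by simp_all
  then have "a = b" using * by metis
  then show "a = b \<and> c = d" using * by simp
qed simp

text \<open>An interval of whole blocks of length \<open>n\<close> sees only the leading digit,
  which makes membership in stretched rectangles exact.\<close>

lemma mult_add_le_iff:
  fixes a b c n :: nat
  assumes "c < n"
  shows "b * n \<le> a * n + c \<longleftrightarrow> b \<le> a"
    and "a * n + c \<le> b * n + (n - 1) \<longleftrightarrow> a \<le> b"
proof -
  have div: "(x * n + y) div n = x" if "y < n" for x y
    using that by simp
  note 1 = div[OF assms, of a]
  have "b * n \<le> x \<longleftrightarrow> b \<le> x div n" for x b
    using assms by (simp add: less_eq_div_iff_mult_less_eq)
  from this[of b "a * n + c"] show "b * n \<le> a * n + c \<longleftrightarrow> b \<le> a" using 1 by simp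
  show "a * n + c \<le> b * n + (n - 1) \<longleftrightarrow> a \<le> b"
  proof
    assume "a * n + c \<le> b * n + (n - 1)"
    then have "(a * n + c) div n \<le> (b * n + (n - 1)) div n" by (rule div_le_mono)
    moreover have "(b * n + (n - 1)) div n = b" using assms by (intro div) simp
    ultimately show "a \<le> b" using 1 by simp
  next
    assume "a \<le> b"
    then have "a * n \<le> b * n" by simp
    then show "a * n + c \<le> b * n + (n - 1)" using assms by linarith
  qed
qed

lemma configuration_Suc:
  assumes "configuration g d k P E"
  shows "\<exists>P' E'. configuration g d (Suc k) P' E'"
proof -
  have P: "finite P" "P \<noteq> {}" "finite E" "inj_on fst P"
    and Ed: "\<And>e. e \<in> E \<Longrightarrow> d \<le> card {p \<in> P. in_rect e p}"
    and Pk: "\<And>p. p \<in> P \<Longrightarrow> k \<le> card {e \<in> E. in_rect e p}"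
    and g: "no_short_cycle (joined P E) g"
    using assms by (auto simp: configuration_def)
  obtain W and lab :: "point \<Rightarrow> nat \<Rightarrow> nat" where W: "finite W" "W \<noteq> {}"
    and lab: "\<And>i v. i \<in> P \<Longrightarrow> v \<in> W \<Longrightarrow> lab i v \<in> W"
    and cls: "\<And>i v. i \<in> P \<Longrightarrow> v \<in> W \<Longrightarrow> d \<le> card {u \<in> W. lab i u = lab i v}"
    and lab_g: "no_short_cycle (\<lambda>i u v. i \<in> P \<and> u \<in> W \<and> v \<in> W \<and> lab i u = lab i v) g"
    by (rule ex_labelling[OF P(1), where d = d and g = g]) (rule that)
  \<comment> \<open>\<open>M\<close> bounds copy numbers and labels and is the base of the x-digits.
    \<open>B\<close>, above all points and all top sides, is the height of a layer.\<close>
  obtain M where M: "\<And>v. v \<in> W \<Longrightarrow> v < M"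
    using W(1) finite_nat_set_iff_bounded by auto
  have "finite (snd ` P \<union> (snd \<circ> snd \<circ> snd) ` E)" using P by simp
  then obtain B where "\<forall>y \<in> snd ` P \<union> (snd \<circ> snd \<circ> snd) ` E. y < B"
    unfolding finite_nat_set_iff_bounded ..
  then have B: "\<And>p. p \<in> P \<Longrightarrow> snd p < B" "\<And>a b c d. (a, b, c, d) \<in> E \<Longrightarrow> d < B"
    by (auto simp: image_Un image_comp ball_Un)
  have lab_less: "lab p v < M" if "p \<in> P" "v \<in> W" for p v using M[OF lab[OF that]] .
  have M0: "0 < M" using W(2) M by fastforce
  \<comment> \<open>The \<open>x\<close>-coordinate sorts lexicographically by strip, class and copy, the \<open>y\<close>-coordinate by copy
    and old height.\<close>
  define pt where "pt p v = ((fst p * M + lab p v) * M + v, v * B + snd p)" for p v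
  \<comment> \<open>A copied rectangle covers whole strips of width \<open>M * M\<close> and moves
    up by \<open>v * B\<close>. A new one covers the block of width \<open>M\<close> that class
    \<open>l\<close> occupies in the strip of \<open>p\<close> and crosses all layers.\<close>
  define old where "old = (\<lambda>(a, b, c, d) v. (a * (M * M), b * (M * M) + (M * M - 1), v * B + c, v * B + d))"
  define new where "new p l = ((fst p * M + l) * M, (fst p * M + l) * M + (M - 1), 0::nat, M * B)"
    for p :: point and l
  have xless: "lab p v * M + v < M * M" if "p \<in> P" "v \<in> W" for p v
  proof -
    have "Suc (lab p v) * M \<le> M * M" using lab_less[OF that] by (intro mult_le_mono) auto
    then show ?thesis using M[OF that(2)] by simp
  qed
  have x_alt: "(fst p * M + lab p v) * M + v = fst p * (M * M) + (lab p v * M + v)" for p v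
    by (simp add: algebra_simps)
  have yless: "u * B + s < v * B + t" if "u < v" "s < B" for u s v t
  proof -
    have "Suc u * B \<le> v * B" using that(1) by (intro mult_le_mono) auto
    then show ?thesis using that(2) by simp
  qed
  \<comment> \<open>Height separates the layers; horizontally a copied rectangle ignores the class
    and copy digits.\<close>
  have F1: "in_rect (old e v) (pt p u) \<longleftrightarrow> u = v \<and> in_rect e p"
    if "p \<in> P" "u \<in> W" "v \<in> W" "e \<in> E" for e p u v
  proof -
    obtain a b c d' where e: "e = (a, b, c, d')" by (cases e)
    obtain x y where p: "p = (x, y)" by (cases p)
    have d': "d' < B" and y: "y < B" using B that e p by auto
    have "v * B + c \<le> u * B + y \<and> u * B + y \<le> v * B + d' \<longleftrightarrow> u = v \<and> c \<le> y \<and> y \<le> d'"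
      using yless[of u v y c] yless[of v u d' y] d' y by (cases u v rule: linorder_cases) auto
    then show ?thesis
      using mult_add_le_iff[OF xless[OF that(1,2)], where a = "fst p"]
      unfolding e old_def pt_def x_alt by (auto simp: p)
  qed
  \<comment> \<open>The two leading x-digits decide; the first one determines the point because
    \<open>fst\<close> is injective on \<open>P\<close>.\<close>
  have F2: "in_rect (new p l) (pt q u) \<longleftrightarrow> q = p \<and> lab q u = l"
    if "p \<in> P" "q \<in> P" "u \<in> W" "l < M" for p q u l
  proof -
    have "u * B + snd q \<le> M * B"
      using yless[of u M "snd q" 0] M[OF that(3)] B(1)[OF that(2)] by simp
    moreover have "fst q * M + lab q u = fst p * M + l \<longleftrightarrow> q = p \<and> lab q u = l"
      using mult_add_eq_iff[OF lab_less[OF that(2,3)] that(4), of "fst q" "fst p"]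
        inj_onD[OF P(4) _ that(2,1)] by auto
    ultimately show ?thesis
      using mult_add_le_iff[OF M[OF that(3)], where a = "fst q * M + lab q u"]
      unfolding new_def pt_def by auto
  qed
  have old_inj: "e = f \<and> u = v" if "e \<in> E" "f \<in> E" "old e u = old f v" for e f u v
  proof -
    obtain a b c h where e: "e = (a, b, c, h)" by (cases e)
    obtain a' b' c' h' where f: "f = (a', b', c', h')" by (cases f)
    \<comment> \<open>The top side is bounded by \<open>B\<close> within its layer, so its
      base-\<open>B\<close> digits reveal the copy.\<close>
    have "u = v \<and> h = h'"
      using mult_add_eq_iff[of h B h' u v] B(2) that by (auto simp: e f old_def)
    moreover have "b = b'"
      using mult_add_eq_iff[of "M * M - 1" "M * M" "M * M - 1" b b'] that(3) M0
      by (simp add: e f old_def)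
    ultimately show ?thesis using that(3) M0 by (simp add: e f old_def)
  qed
  \<comment> \<open>Copied rectangles end strictly below height \<open>M * B\<close>, where all new
    ones end.\<close>
  have old_new: "old e v \<noteq> new p l" if "e \<in> E" "v \<in> W" for e v p l
  proof -
    obtain a b c h where e: "e = (a, b, c, h)" by (cases e)
    then show ?thesis using yless[of v M h 0] M[OF that(2)] B(2) that(1)
      by (auto simp: old_def new_def)
  qed
  \<comment> \<open>The x-coordinate alone determines point and copy, which restores injectivity of
    \<open>fst\<close> for the new points.\<close>
  have pt_inj: "p = q \<and> u = v"
    if "p \<in> P" "q \<in> P" "u \<in> W" "v \<in> W" "fst (pt p u) = fst (pt q v)" for p q u v
  proof -
    have "(fst p * M + lab p u) * M + u = (fst q * M + lab q v) * M + v"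
      using that(5) by (simp only: pt_def fst_conv)
    then have x: "fst p * M + lab p u = fst q * M + lab q v" and "u = v"
      unfolding mult_add_eq_iff[OF M[OF that(3)] M[OF that(4)]] by blast+
    moreover have "fst p = fst q"
      using x unfolding mult_add_eq_iff[OF lab_less[OF that(1,3)] lab_less[OF that(2,4)]] by blast
    ultimately show ?thesis using inj_onD[OF P(4) _ that(1,2)] by simp
  qed
  define P' where "P' = (\<lambda>(p, v). pt p v) ` (P \<times> W)"
  define E' where "E' = (\<lambda>(e, v). old e v) ` (E \<times> W) \<union> (\<lambda>(p, v). new p (lab p v)) ` (P \<times> W)"
  have P'I: "pt p v \<in> P'" if "p \<in> P" "v \<in> W" for p v
    using that by (auto simp: P'_def)
  have oldI: "old e v \<in> E'" if "e \<in> E" "v \<in> W" for e v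
    using that unfolding E'_def by (intro UnI1 image_eqI[of _ _ "(e, v)"]) auto
  have newI: "new p (lab p v) \<in> E'" if "p \<in> P" "v \<in> W" for p v
    using that unfolding E'_def by (intro UnI2 image_eqI[of _ _ "(p, v)"]) auto
  have in_old: "in_rect (old e v) (pt p v)" if "e \<in> E" "v \<in> W" "p \<in> P" "in_rect e p" for e v p
    using F1 that by blast
  have in_new: "in_rect (new p (lab p v)) (pt p u)"
    if "p \<in> P" "u \<in> W" "v \<in> W" "lab p u = lab p v" for p u v
    using F2[OF that(1,1,2) lab_less[OF that(1,3)]] that(4) by simp
  have fin: "finite P'" "finite E'" using P W by (auto simp: P'_def E'_def)
  have "configuration g d (Suc k) P' E'"
    unfolding configuration_def
  proof (intro conjI ballI)
    show "finite P'" "finite E'" by (fact fin)+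
    show "P' \<noteq> {}" using P W by (auto simp: P'_def)
    show "inj_on fst P'"
    proof (rule inj_onI)
      fix x y assume xy: "x \<in> P'" "y \<in> P'" "fst x = fst y"
      then obtain p u q v where "p \<in> P" "u \<in> W" "x = pt p u" "q \<in> P" "v \<in> W" "y = pt q v"
        by (auto simp: P'_def)
      then show "x = y" using pt_inj[of p q u v] xy(3) by simp
    qed
    show "d \<le> card {p \<in> P'. in_rect e p}" if "e \<in> E'" for e
    proof -
      have "\<exists>X. X \<subseteq> {p \<in> P'. in_rect e p} \<and> d \<le> card X"
        using that unfolding E'_def
      proof (elim UnE imageE SigmaE, simp_all)
        fix f v assume f: "f \<in> E" "v \<in> W"
        have "inj_on (\<lambda>p. pt p v) {p \<in> P. in_rect f p}"
          by (rule inj_onI) (use pt_inj f in auto)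
        then have "d \<le> card ((\<lambda>p. pt p v) ` {p \<in> P. in_rect f p})"
          using Ed[OF f(1)] by (simp add: card_image)
        moreover have "(\<lambda>p. pt p v) ` {p \<in> P. in_rect f p} \<subseteq> {p \<in> P'. in_rect (old f v) p}"
          using in_old P'I f by blast
        ultimately show "\<exists>X. X \<subseteq> {p \<in> P'. in_rect (old f v) p} \<and> d \<le> card X" by blast
      next
        fix p v assume p: "p \<in> P" "v \<in> W"
        have "inj_on (pt p) {u \<in> W. lab p u = lab p v}"
          by (rule inj_onI) (use pt_inj p in auto)
        then have "d \<le> card (pt p ` {u \<in> W. lab p u = lab p v})"
          using cls[OF p] by (simp add: card_image)
        moreover have "pt p ` {u \<in> W. lab p u = lab p v} \<subseteq> {q \<in> P'. in_rect (new p (lab p v)) q}"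
          using in_new P'I p by blast
        ultimately show "\<exists>X. X \<subseteq> {q \<in> P'. in_rect (new p (lab p v)) q} \<and> d \<le> card X" by blast
      qed
      moreover have "finite {p \<in> P'. in_rect e p}" using fin by simp
      ultimately show ?thesis by (meson card_mono le_trans)
    qed
    show "Suc k \<le> card {e \<in> E'. in_rect e p'}" if p': "p' \<in> P'" for p'
    proof -
      obtain p v where p: "p \<in> P" "v \<in> W" "p' = pt p v" using p' by (auto simp: P'_def)
      \<comment> \<open>The copied rectangles in layer \<open>v\<close> supply \<open>k\<close>, the
        rectangle of the class of \<open>v\<close> supplies one more.\<close>
      let ?O = "(\<lambda>e. old e v) ` {e \<in> E. in_rect e p}"
      have "inj_on (\<lambda>e. old e v) {e \<in> E. in_rect e p}"
        by (rule inj_onI) (use old_inj in auto)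
      then have "k \<le> card ?O" using Pk[OF p(1)] by (simp add: card_image)
      moreover have "new p (lab p v) \<notin> ?O" by (simp add: image_iff old_new[OF _ p(2), symmetric])
      moreover have "finite ?O" using P by simp
      ultimately have "Suc k \<le> card (insert (new p (lab p v)) ?O)" by simp
      also have "insert (new p (lab p v)) ?O \<subseteq> {e \<in> E'. in_rect e p'}"
        using in_old in_new oldI newI p by blast
      then have "card (insert (new p (lab p v)) ?O) \<le> card {e \<in> E'. in_rect e p'}"
        using fin by (intro card_mono) auto
      finally show ?thesis .
    qed
    show "no_short_cycle (joined P' E') g"
    proof (rule no_short_cycle_layers[OF g lab_g, where pt = pt and old = old and new = new])
      show "p = q \<and> u = v" if "p \<in> P" "q \<in> P" "u \<in> W" "v \<in> W" "pt p u = pt q v" for p q u v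
        using pt_inj that by simp
      fix e x y assume "joined P' E' e x y"
      then obtain p u q v where *: "e \<in> E'" "p \<in> P" "u \<in> W" "q \<in> P" "v \<in> W" "x = pt p u" "y = pt q v"
        "in_rect e (pt p u)" "in_rect e (pt q v)"
        by (auto simp: joined_def P'_def)
      from *(1) consider f w where "f \<in> E" "w \<in> W" "e = old f w"
        | r w where "r \<in> P" "w \<in> W" "e = new r (lab r w)"
        by (auto simp: E'_def)
      then show "(\<exists>f u p q. u \<in> W \<and> p \<in> P \<and> q \<in> P \<and> e = old f u \<and> x = pt p u \<and> y = pt q u \<and>
            joined P E f p q) \<or>
          (\<exists>p u v. p \<in> P \<and> u \<in> W \<and> v \<in> W \<and> lab p u = lab p v \<and> e = new p (lab p u) \<and>
            x = pt p u \<and> y = pt p v)"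
      proof cases
        case 1
        then have "p \<in> P" "q \<in> P" "u = w" "v = w" "in_rect f p" "in_rect f q"
          using F1[of p u w f] F1[of q v w f] * by auto
        then show ?thesis using * 1 unfolding joined_def by blast
      next
        case 2
        note less = lab_less[OF 2(1,2)]
        have "in_rect (new r (lab r w)) (pt p u)" "in_rect (new r (lab r w)) (pt q v)"
          using *(8,9) 2(3) by simp_all
        then have "p = r" "lab p u = lab r w" "q = r" "lab q v = lab r w"
          using F2[OF 2(1) *(2,3) less] F2[OF 2(1) *(4,5) less] by blast+
        then show ?thesis using * 2 by metis
      qed
    qed
  qed
  then show ?thesis by blast
qed

text \<open>The induction starts from a single point without rectangles, where the condition on
  rectangles is vacuous.\<close>

lemma ex_configuration: "\<exists>P E. configuration g d k P E"
proof (induction k)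
  case 0
  have "\<not> walk (joined {(0, 0)} {}) n p e q" for n p e q
  proof
    assume "walk (joined {(0, 0)} {}) n p e q"
    then show False by cases (auto simp: joined_def)
  qed
  then have "configuration g d 0 {(0, 0)} {}"
    by (auto simp: configuration_def no_short_cycle_def)
  then show ?case by blast
qed (auto dest: configuration_Suc)

subsection \<open>Boxes\<close>

lemma (in pre_digraph) cas_last: "cas u p v \<Longrightarrow> p \<noteq> [] \<Longrightarrow> head G (last p) = v"
  by (induction p arbitrary: u) auto

text \<open>Unrolling a cycle periodically allows it to be read from any vertex. Vertices two steps
  apart differ because the length is at least 3.\<close>

lemma cycle_sequence:
  fixes G :: "'a pair_pre_digraph"
  assumes "pre_digraph.cycle (with_proj G) p" "3 \<le> length p"
  obtains c where "\<And>n. (c n, c (Suc n)) \<in> parcs G" "\<And>n. c (n + length p) = c n"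
    "\<And>n. c n \<noteq> c (n + 2)"
proof -
  interpret pre_digraph "with_proj G" .
  obtain u where u: "awalk u p u" "distinct (tl (awalk_verts u p))" and ne: "p \<noteq> []"
    using assms(1) unfolding cycle_def by blast
  have p: "set p \<subseteq> parcs G" and cas: "cas u p u" using u(1) by (auto simp: awalk_def)
  have verts: "awalk_verts u p = map fst p @ [snd (last p)]"
    using awalk_verts_conv[of u p] ne by simp
  have verts': "awalk_verts u p = fst (hd p) # map snd p"
    using awalk_verts_conv'[OF cas] ne by simp
  have dist: "distinct (map snd p)" using u(2) unfolding verts' by simp
  have "fst (hd p) = u" "snd (last p) = u"
    using cas cas_simp[OF ne, of u u] cas_last[OF cas ne] by simp_all
  then have wrap: "fst (p ! 0) = snd (p ! (length p - 1))"
    using ne by (simp add: hd_conv_nth last_conv_nth)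
  have next_: "fst (p ! Suc i) = snd (p ! i)" if "Suc i < length p" for i
  proof -
    have "(map fst p @ [snd (last p)]) ! Suc i = (fst (hd p) # map snd p) ! Suc i"
      using verts verts' by simp
    then show ?thesis using that by (simp add: nth_append)
  qed
  \<comment> \<open>Heads of arcs are used, since the distinctness in \<open>cycle\<close> concerns
    exactly \<open>map snd p\<close>.\<close>
  define c where "c n = snd (p ! (n mod length p))" for n
  have arc: "(c n, c (Suc n)) = p ! (Suc n mod length p)" for n
  proof (cases "Suc (n mod length p) = length p")
    case True
    then have "Suc n mod length p = 0" "n mod length p = length p - 1"
      by (simp_all add: mod_Suc)
    then show ?thesis using wrap by (simp add: c_def prod_eq_iff)
  next
    case False
    then have "Suc n mod length p = Suc (n mod length p)" by (simp add: mod_Suc)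
    moreover have "Suc (n mod length p) < length p"
      using False ne by (metis Suc_lessI length_greater_0_conv mod_less_divisor)
    ultimately show ?thesis using next_[of "n mod length p"] by (simp add: c_def prod_eq_iff)
  qed
  have mod: "n mod length p \<noteq> (n + 2) mod length p" for n
  proof
    assume "n mod length p = (n + 2) mod length p"
    then have "length p dvd (n + 2) - n" by (metis mod_eq_dvd_iff_nat le_add1)
    then show False using assms(2) by (auto dest: dvd_imp_le)
  qed
  show thesis
  proof
    show "(c n, c (Suc n)) \<in> parcs G" for n
      unfolding arc using p ne by (auto intro!: subsetD[OF p] nth_mem)
    show "c (n + length p) = c n" for n by (simp add: c_def)
    show "c n \<noteq> c (n + 2)" for n
    proof
      assume "c n = c (n + 2)"
      then have "map snd p ! (n mod length p) = map snd p ! ((n + 2) mod length p)"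
        using ne by (simp add: c_def)
      then show False using mod[of n] nth_eq_iff_index_eq[OF dist] ne by simp
    qed
  qed
qed

text \<open>A cycle alternates between points and hyperedges, so every second vertex traces a closed
  walk of half its length \<open>h\<close>. Then \<open>h > g\<close>, and the cycle has length
  \<open>2 * h\<close>.\<close>

lemma girth_incidence_graph:
  fixes G :: "'b pair_pre_digraph" and F :: "'p \<Rightarrow> 'b" and S :: "'e \<Rightarrow> 'b"
  assumes arcs: "\<And>A B. (A, B) \<in> parcs G \<Longrightarrow>
      \<exists>p e. p \<in> P \<and> e \<in> E \<and> I e p \<and> (A = F p \<and> B = S e \<or> A = S e \<and> B = F p)"
    and F: "inj_on F P" and S: "inj_on S E"
    and disj: "\<And>p e. p \<in> P \<Longrightarrow> e \<in> E \<Longrightarrow> F p \<noteq> S e"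
    and g: "no_short_cycle (\<lambda>e p q. e \<in> E \<and> p \<in> P \<and> q \<in> P \<and> I e p \<and> I e q) g"
  shows "enat g \<le> girth G"
  unfolding girth_def
proof (rule INF_greatest, clarsimp)
  fix w assume w: "pre_digraph.cycle (with_proj G) w" "3 \<le> length w"
  obtain c where c: "\<And>n. (c n, c (Suc n)) \<in> parcs G" "\<And>n. c (n + length w) = c n"
    "\<And>n. c n \<noteq> c (n + 2)" using cycle_sequence[OF w] by blast
  have alt: "c n \<in> F ` P \<longleftrightarrow> c (Suc n) \<notin> F ` P" for n
    using arcs[OF c(1)[of n]] disj by force
  have parity: "c (m + n) \<in> F ` P \<longleftrightarrow> (even n \<longleftrightarrow> c m \<in> F ` P)" for m n
  proof (induction n)
    case (Suc n)
    then show ?case using alt[of "m + n"] by auto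
  qed simp
  have "even (length w)" using parity[of 0 "length w"] c(2)[of 0] by auto
  then obtain h where h: "length w = 2 * h" by blast
  \<comment> \<open>Reading starts at a point, which need not be the first vertex of the
    cycle.\<close>
  obtain m where m: "c m \<in> F ` P" using alt by blast
  have vp: "\<exists>p\<in>P. c (m + 2 * j) = F p" for j using parity[of m "2 * j"] m by auto
  have ve: "\<exists>p e q. p \<in> P \<and> q \<in> P \<and> e \<in> E \<and> I e p \<and> I e q \<and>
      c (m + 2 * j) = F p \<and> c (m + 2 * j + 1) = S e \<and> c (m + 2 * Suc j) = F q" for j
  proof -
    have 1: "c (m + 2 * j) \<in> F ` P" "c (m + 2 * j + 1) \<notin> F ` P" "c (m + 2 * j + 2) \<in> F ` P"
      using parity[of m "2 * j"] parity[of m "2 * j + 1"] parity[of m "2 * j + 2"] m by auto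
    from arcs[OF c(1)[of "m + 2 * j"]] 1 obtain p e where
      p: "p \<in> P" "e \<in> E" "I e p" "c (m + 2 * j) = F p" "c (m + 2 * j + 1) = S e" by auto
    from arcs[OF c(1)[of "m + 2 * j + 1"]] 1 obtain q e' where
      q: "q \<in> P" "e' \<in> E" "I e' q" "c (m + 2 * j + 2) = F q" "c (m + 2 * j + 1) = S e'" by auto
    have "e = e'" using inj_onD[OF S] p q by metis
    then show ?thesis using p q by (intro exI[of _ p] exI[of _ e] exI[of _ q]) simp
  qed
  obtain x where x: "\<And>j. x j \<in> P" "\<And>j. c (m + 2 * j) = F (x j)"
    using vp by metis
  have "\<exists>e. e \<in> E \<and> I e (x j) \<and> I e (x (Suc j)) \<and> c (m + 2 * j + 1) = S e" for j
    using ve[of j] x[of j] x[of "Suc j"] inj_onD[OF F] by metis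
  then obtain e where e: "\<And>j. e j \<in> E" "\<And>j. I (e j) (x j)" "\<And>j. I (e j) (x (Suc j))"
    "\<And>j. c (m + 2 * j + 1) = S (e j)" by metis
  let ?R = "\<lambda>e p q. e \<in> E \<and> p \<in> P \<and> q \<in> P \<and> I e p \<and> I e q"
  \<comment> \<open>That vertices two apart differ gives both distinctness conditions of
    \<open>walk\<close>: here for points, next for hyperedges.\<close>
  have nx: "x j \<noteq> x (Suc j)" for j using c(3)[of "m + 2 * j"] x(2)[of j] x(2)[of "Suc j"] by auto
  have ne: "e j \<noteq> e (Suc j)" for j using c(3)[of "m + 2 * j + 1"] e(4)[of j] e(4)[of "Suc j"] by auto
  have walk: "walk ?R (Suc j) (x 0) (e j) (x (Suc j))" for j
  proof (induction j)
    case 0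
    show ?case using walk_one[of ?R "e 0" "x 0" "x (Suc 0)"] x e nx by simp
  next
    case (Suc j)
    then show ?case by (rule walk_Suc) (use x e nx ne in auto)
  qed
  obtain j where j: "h = Suc j" using h w(2) by (cases h) auto
  have "F (x h) = F (x 0)" using x(2)[of h] x(2)[of 0] c(2)[of m] h by simp
  then have "x (Suc j) = x 0" using inj_onD[OF F] x(1) j by metis
  then have "walk ?R h (x 0) (e j) (x 0)" using walk[of j] j by simp
  then have "\<not> h \<le> g" using g unfolding no_short_cycle_def by blast
  then show "g \<le> length w" using h by simp
qed

section \<open>Pillars and slabs in space\<close>

text \<open>The top \<open>Suc h\<close> keeps a pillar from being flat even if
  \<open>h = 0\<close>, so it never equals a slab.\<close>

definition pillar :: "nat \<Rightarrow> point \<Rightarrow> (real ^ 3) set" where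
  "pillar h p = cbox (vector [real (fst p), real (snd p), 0]) (vector [real (fst p), real (snd p), real (Suc h)])"

fun slab :: "nat \<Rightarrow> rect \<Rightarrow> (real ^ 3) set" where
  "slab h (a, b, c, d) = cbox (vector [real a, real c, real h]) (vector [real b, real d, real h])"

lemma mem_pillar:
  "z \<in> pillar h p \<longleftrightarrow> z $ 1 = real (fst p) \<and> z $ 2 = real (snd p) \<and> 0 \<le> z $ 3 \<and> z $ 3 \<le> real (Suc h)"
  by (auto simp: pillar_def mem_box_cart forall_3)

lemma mem_slab:
  "z \<in> slab h (a, b, c, d) \<longleftrightarrow>
     real a \<le> z $ 1 \<and> z $ 1 \<le> real b \<and> real c \<le> z $ 2 \<and> z $ 2 \<le> real d \<and> z $ 3 = real h"
  by (auto simp: mem_box_cart forall_3)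

lemma slab_Int_slab: "slab h e \<inter> slab k f \<noteq> {} \<Longrightarrow> h = k"
  by (cases e; cases f) (auto simp: mem_slab simp del: slab.simps)

lemma pillar_Int_pillar: "pillar h p \<inter> pillar k q \<noteq> {} \<Longrightarrow> p = q"
  by (auto simp: mem_pillar prod_eq_iff)

lemma pillar_nonempty: "pillar h p \<noteq> {}"
proof -
  have "vector [real (fst p), real (snd p), 0] \<in> pillar h p" by (simp add: mem_pillar)
  then show ?thesis by blast
qed

lemma pillar_Int_slab:
  assumes "h \<le> k"
  shows "pillar k p \<inter> slab h e \<noteq> {} \<longleftrightarrow> in_rect e p"
proof -
  obtain a b c d where e: "e = (a, b, c, d)" by (cases e)
  obtain x y where p: "p = (x, y)" by (cases p)
  show ?thesis
  proof
    assume "in_rect e p"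
    then have "vector [real x, real y, real h] \<in> pillar k p \<inter> slab h e"
      using assms by (simp add: e p mem_pillar mem_slab del: slab.simps)
    then show "pillar k p \<inter> slab h e \<noteq> {}" by blast
  qed (auto simp: e p mem_pillar mem_slab simp del: slab.simps)
qed

lemma pillar_neq_slab: "pillar k p \<noteq> slab h e"
proof
  obtain a b c d where e: "e = (a, b, c, d)" by (cases e)
  assume *: "pillar k p = slab h e"
  have "vector [real (fst p), real (snd p), 0] \<in> pillar k p"
    "vector [real (fst p), real (snd p), 1] \<in> pillar k p" by (simp_all add: mem_pillar)
  then show False unfolding * e mem_slab by simp
qed

lemma axis_aligned_box_pillar: "axis_aligned_box (pillar h p)"
  unfolding axis_aligned_box_def pillar_def
  by (rule exI, rule exI, rule conjI[OF _ refl]) (simp add: forall_3)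

text \<open>The type \<open>rect\<close> does not order the sides; a point inside does.\<close>

lemma axis_aligned_box_slab:
  assumes "in_rect e p"
  shows "axis_aligned_box (slab h e)"
proof -
  obtain a b c d where e: "e = (a, b, c, d)" by (cases e)
  have "a \<le> b" "c \<le> d" using assms by (cases p; auto simp: e)+
  then have "\<forall>i. (vector [real a, real c, real h] :: real ^ 3) $ i \<le> vector [real b, real d, real h] $ i"
    by (simp add: forall_3)
  then show ?thesis unfolding axis_aligned_box_def e slab.simps by blast
qed

lemma out_degree_intersection_graph:
  fixes A :: "'a set"
  assumes "A \<in> \<B>"
  shows "out_degree (with_proj (intersection_graph \<B>)) A = card {B \<in> \<B>. A \<noteq> B \<and> A \<inter> B \<noteq> {}}"
proof -
  have "out_arcs (with_proj (intersection_graph \<B>)) A = Pair A ` {B \<in> \<B>. A \<noteq> B \<and> A \<inter> B \<noteq> {}}"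
  proof (rule set_eqI)
    fix a :: "'a set \<times> 'a set"
    show "a \<in> out_arcs (with_proj (intersection_graph \<B>)) A \<longleftrightarrow>
        a \<in> Pair A ` {B \<in> \<B>. A \<noteq> B \<and> A \<inter> B \<noteq> {}}"
      using assms by (cases a) (simp add: out_arcs_def intersection_graph_def image_iff conj_ac cong: conj_cong)
  qed
  then show ?thesis by (simp add: out_degree_def card_image inj_on_def)
qed

theorem corollary3:
  fixes g d :: nat
  assumes "g \<ge> 3" and "d \<ge> 1"
  shows "\<exists>\<B> :: (real ^ 3) set set.
           finite \<B> \<and> \<B> \<noteq> {} \<and> (\<forall>B \<in> \<B>. axis_aligned_box B) \<and>
           bipartite (intersection_graph \<B>) \<and>
           girth (intersection_graph \<B>) \<ge> enat g \<and>
           min_degree (intersection_graph \<B>) \<ge> d"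
proof -
  obtain P E where "configuration g d d P E" using ex_configuration by blast
  then have P: "finite P" "P \<noteq> {}" "finite E"
    and Ed: "\<And>e. e \<in> E \<Longrightarrow> d \<le> card {p \<in> P. in_rect e p}"
    and Pd: "\<And>p. p \<in> P \<Longrightarrow> d \<le> card {e \<in> E. in_rect e p}"
    and g: "no_short_cycle (joined P E) g"
    by (auto simp: configuration_def)
  \<comment> \<open>The code of a rectangle is the height of its slab, so slabs are pairwise
    disjoint; \<open>h\<close> bounds these heights, so every pillar reaches all of them.\<close>
  obtain h where h: "\<And>e. e \<in> E \<Longrightarrow> to_nat e \<le> h"
    using finite_nat_set_iff_bounded_le[of "to_nat ` E"] P(3) by auto
  define F where "F = pillar h"
  define S where "S e = slab (to_nat e) e" for e
  define \<B> where "\<B> = F ` P \<union> S ` E"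
  have FS: "F p \<inter> S e \<noteq> {} \<longleftrightarrow> in_rect e p" if "e \<in> E" for p e
    unfolding F_def S_def by (rule pillar_Int_slab[OF h[OF that]])
  have meet: "F p \<inter> S e \<noteq> {}" "S e \<inter> F p \<noteq> {}" if "e \<in> E" "in_rect e p" for p e
    using FS that by blast+
  have FF: "p = q" if "F p \<inter> F q \<noteq> {}" for p q
    using pillar_Int_pillar that unfolding F_def .
  have SS: "e = f" if "S e \<inter> S f \<noteq> {}" for e f
    using slab_Int_slab that unfolding S_def by fastforce
  have neq: "F p \<noteq> S e" for p e unfolding F_def S_def by (rule pillar_neq_slab)
  \<comment> \<open>Here \<open>d >= 1\<close> enters: a rectangle with a point on it yields a
    non-empty slab and a genuine box.\<close>
  have inc: "\<exists>p\<in>P. in_rect e p" if "e \<in> E" for e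
  proof -
    have "{p \<in> P. in_rect e p} \<noteq> {}" using Ed[OF that] assms(2) by (metis card.empty not_one_le_zero le_trans)
    then show ?thesis by blast
  qed
  have injF: "inj_on F P" by (rule inj_onI) (metis FF F_def Int_absorb pillar_nonempty)
  have injS: "inj_on S E"
  proof (rule inj_onI)
    fix e f assume "e \<in> E" "f \<in> E" "S e = S f"
    moreover have "S e \<noteq> {}" using inc FS \<open>e \<in> E\<close> by blast
    ultimately show "e = f" using SS by blast
  qed
  have arcs: "\<exists>p e. p \<in> P \<and> e \<in> E \<and> in_rect e p \<and> (A = F p \<and> B = S e \<or> A = S e \<and> B = F p)"
    if "(A, B) \<in> parcs (intersection_graph \<B>)" for A B
  proof -
    have AB: "A \<in> F ` P \<or> A \<in> S ` E" "B \<in> F ` P \<or> B \<in> S ` E" "A \<noteq> B" "A \<inter> B \<noteq> {}"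
      using that by (auto simp: intersection_graph_def \<B>_def)
    then consider p e where "p \<in> P" "e \<in> E" "A = F p" "B = S e"
      | p e where "p \<in> P" "e \<in> E" "A = S e" "B = F p"
    proof -
      from AB(1,2) show thesis
      proof (elim disjE imageE)
        fix p q assume "A = F p" "B = F q"
        then show thesis using FF[of p q] AB(3,4) by simp
      next
        fix e f assume "A = S e" "B = S f"
        then show thesis using SS[of e f] AB(3,4) by simp
      qed (use that in blast)+
    qed
    then show ?thesis
    proof cases
      case 1
      then show ?thesis using FS[of e p] AB(4) by blast
    next
      case 2
      then show ?thesis using FS[of e p] AB(4) by blast
    qed
  qed
  have deg: "d \<le> out_degree (with_proj (intersection_graph \<B>)) A" if "A \<in> \<B>" for A
  proof -
    let ?N = "{B \<in> \<B>. A \<noteq> B \<and> A \<inter> B \<noteq> {}}"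
    have fin: "finite ?N" using P by (simp add: \<B>_def)
    have "\<exists>X. X \<subseteq> ?N \<and> d \<le> card X"
    proof (cases "A \<in> F ` P")
      case True
      then obtain p where p: "p \<in> P" "A = F p" by blast
      have "card (S ` {e \<in> E. in_rect e p}) = card {e \<in> E. in_rect e p}"
        by (rule card_image, rule inj_on_subset[OF injS]) auto
      moreover have "S ` {e \<in> E. in_rect e p} \<subseteq> ?N"
        using p meet neq unfolding \<B>_def by blast
      ultimately show ?thesis using Pd[OF p(1)]
        by (intro exI[of _ "S ` {e \<in> E. in_rect e p}"] conjI) (assumption, linarith)
    next
      case False
      then obtain e where e: "e \<in> E" "A = S e" using \<open>A \<in> \<B>\<close> unfolding \<B>_def by blast
      have "card (F ` {p \<in> P. in_rect e p}) = card {p \<in> P. in_rect e p}"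
        by (rule card_image, rule inj_on_subset[OF injF]) auto
      moreover have "F ` {p \<in> P. in_rect e p} \<subseteq> ?N"
        using e meet neq[symmetric] unfolding \<B>_def by blast
      ultimately show ?thesis using Ed[OF e(1)]
        by (intro exI[of _ "F ` {p \<in> P. in_rect e p}"] conjI) (assumption, linarith)
    qed
    then show ?thesis
      unfolding out_degree_intersection_graph[OF that] using fin by (meson card_mono le_trans)
  qed
  show ?thesis
  proof (intro exI[of _ \<B>] conjI ballI)
    show "finite \<B>" "\<B> \<noteq> {}" using P by (auto simp: \<B>_def)
  next
    fix B assume "B \<in> \<B>"
    then consider p where "B = F p" | e where "e \<in> E" "B = S e" unfolding \<B>_def by blast
    then show "axis_aligned_box B"
    proof cases
      case 1
      then show ?thesis by (simp only: F_def axis_aligned_box_pillar)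
    next
      case 2
      from inc[OF 2(1)] obtain p where "in_rect e p" ..
      then show ?thesis unfolding 2(2) S_def by (rule axis_aligned_box_slab)
    qed
  next
    show "bipartite (intersection_graph \<B>)"
      unfolding bipartite_def
    proof (rule exI[of _ "F ` P"], rule exI[of _ "S ` E"], intro conjI)
      show "pverts (intersection_graph \<B>) = F ` P \<union> S ` E"
        by (simp add: intersection_graph_def \<B>_def)
      show "F ` P \<inter> S ` E = {}" by (auto simp: neq)
      show "\<forall>(u, v)\<in>parcs (intersection_graph \<B>).
          u \<in> F ` P \<and> v \<in> S ` E \<or> u \<in> S ` E \<and> v \<in> F ` P"
      proof (rule ballI, unfold case_prod_unfold)
        fix x assume "x \<in> parcs (intersection_graph \<B>)"
        then have "(fst x, snd x) \<in> parcs (intersection_graph \<B>)" by simp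
        from arcs[OF this] show "fst x \<in> F ` P \<and> snd x \<in> S ` E \<or> fst x \<in> S ` E \<and> snd x \<in> F ` P"
          by (elim exE conjE disjE) simp_all
      qed
    qed
    show "enat g \<le> girth (intersection_graph \<B>)"
      by (rule girth_incidence_graph[where I = in_rect, OF arcs injF injS neq])
        (use g in \<open>unfold joined_def[abs_def]\<close>)
    show "d \<le> min_degree (intersection_graph \<B>)"
      unfolding min_degree_def using P deg
      by (subst Min_ge_iff) (simp_all add: intersection_graph_def \<B>_def)
  qed
qed

end
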